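(* Fix a review epoch $r<R$ and a capacity level $I$, and assume the following. (A1) Quantity-value regularity. For each $a\in\{0,1\}$, the feasible set $\mathcal Q_r=[0,\bar q_r]$ is compact with $\bar q_r>0$; $O_r^a(q;m,I)$ is continuous in $(q,m)$, convex in $q$, and has decreasing differences in $(q,m)$ (that is, for $q\le q'$ the difference $O_r^a(q';m,I)-O_r^a(q;m,I)$ is nonincreasing in $m$); and the right marginal value of deployment at zero, $$\psi_r^a(m;I)=\left.\frac{\partial O_r^a(q;m,I)}{\partial q}\right|_{q=0^+},$$ exists, is continuous in $m$, and is strictly decreasing in $m$. (A2) Preservation-value single crossing. $G_r(m,I)$ is continuous and nondecreasing in $m\in\mathcal M_r$. (A3) Interior crossings. There exist $\underline m_r^P<\overline m_r^P$ in $\mathcal M_r$ such that $G_r(\underline m_r^P,I)<k_r<G_r(\overline m_r^P,I)$ and $G_r(\cdot,I)$ is strictly increasing on $[\underline m_r^P,\overline m_r^P]$. For each $a\in\{0,1\}$, there exist $\underline m_r^a<\overline m_r^a$ in $\mathcal M_r$ such that $\psi_r^a(\underline m_r^a;I)>0>\psi_r^a(\overline m_r^a;I)$. Then: (i) For each $a\in\{0,1\}$, the smallest conditional optimizer $q_r^{a*}(m,I)$ is nondecreasing in $m$. (ii) There exist unique thresholds $m_r^P(k_r;I)$, $m_r^{D,0}(I)$, $m_r^{D,1}(I)$ in $\mathcal M_r$ satisfying $$G_r(m_r^P(k_r;I),I)=k_r,\qquad \psi_r^0(m_r^{D,0}(I);I)=0,\qquad \psi_r^1(m_r^{D,1}(I);I)=0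 .$$ (iii) With ties resolved in favor of closing at the preservation boundary and of zero deployment at the deployment boundaries, the mode of the optimal open-channel action at scalar belief $m_r$ is $$\begin{cases} \text{Exit}, & m_r\le m_r^P(k_r;I)\text{ and } m_r\le m_r^{D,0}(I),\\ \text{Terminal Response}, & m_r\le m_r^P(k_r;I)\text{ and } m_r> m_r^{D,0}(I),\\ \text{Standby}, & m_r> m_r^P(k_r;I)\text{ and } m_r\le m_r^{D,1}(I),\\ \text{Sustained Response}, & m_r> m_r^P(k_r;I)\text{ and } m_r> m_r^{D,1}(I). \end{cases}$$ (iv) Holding $k_{r+1},\ldots,k_R$ and all other model primitives fixed, the current readiness cost $k_r$ shifts only the preservation boundary: if $k_r'>k_r$ and both corresponding preservation thresholds exist, then $m_r^P(k_r';I)>m_r^P(k_r;I)$, whereas $m_r^{D,0}(I)$ and $m_r^{D,1}(I)$ are unaffected by the current $k_r$.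
   Context: Model. A firm reviews service capacity at epochs $r=1,\ldots,R$. $D_r\ge 0$ is the random workload demand in the interval after review $r$; $I\ge0$ is the serviceable capacity at the beginning of the review. If the response channel is open, the firm chooses a deployment quantity $q\in\mathcal Q_r=[0,\bar q_r]$ and the next channel state $o_{r+1}=a\in\{0,1\}$ ($a=1$: the channel is preserved; $a=0$: it is closed after the current interval). A closed channel stays closed, and no further deployment is then feasible. The unit deployment cost is $c_r$; the readiness cost $k_r$ is paid at review $r$ if and only if $o_{r+1}=1$; the operating cost is $\ell_r(I,q,D_r)=h[I+q-D_r]^++b[D_r-I-q]^+$ with $h,b\ge 0$ and $[x]^+=\max\{x,0\}$. The next capacity state is $I_{r+1}(q)=g_r(I,q)$ for a given transition function $g_r$ (not depending on demand). Scalar belief. The belief about remaining workload is summarized by a scalar $m\in\mathcal M_r$, where $\mathcal M_r\subseteq\mathbb R$ is an interval. The conditional law of $D_r$ given $m$ is specified, and $m_{r+1}(q)$ is the next scalar belief, generated by the served-demand observation $\min\{D_r,I+q\}$ together with the known capacity limit $I+q$. Value functions. $V_r^1(m,I)$ and $V_r^0(m,I)$ are the minimum expected costs from review $r$ onward when the channel is open and closed, with $V_{R+1}^0=V_{R+1}^1=0$. For $a\in\{0,1\}$, $$O_r^a(q;m,I)=c_rq+\mathbb E\big[\ell_r(I,q,D_r)+V_{r+1}^a(m_{r+1}(q),I_{r+1}(q))\mid m\big],$$ $$A_r^a(m,I)=\min_{q\in\mathcal Q_r}O_r^a(q;m,I),\qquad q_r^{a*}(m,I)=\text{the smallest element of }\arg\min_{q\in\mathcal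 Q_r}O_r^a(q;m,I),$$ $$G_r(m,I)=A_r^0(m,I)-A_r^1(m,I),$$ $$V_r^0(m,I)=\mathbb E\big[\ell_r(I,0,D_r)+V_{r+1}^0(m_{r+1}(0),I_{r+1}(0))\mid m\big],\qquad V_r^1(m,I)=\min\{A_r^0(m,I),\,k_r+A_r^1(m,I)\}.$$ An optimal open-channel action minimizes $O_r^a(q;m,I)+k_ra$ over $(q,a)\in\mathcal Q_r\times\{0,1\}$. Standing regularity: stage costs are measurable and integrable, capacity and belief transitions are measurable kernels, the side-specific objectives are lower semicontinuous in $q$, so Bellman expectations are finite and minimizers exist. Modes of an open-channel action $(q,o_{r+1})$: Exit means $q=0,o_{r+1}=0$; Standby means $q=0,o_{r+1}=1$; Terminal Response means $q>0,o_{r+1}=0$; Sustained Response means $q>0,o_{r+1}=1$. *)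

theory Defs
  imports "HOL-Probability.Probability"
begin

text \<open>
  Reviews are numbered \<open>1, \<dots>, horizon\<close>.  A channel state is a \<^typ>\<open>bool\<close>: \<^const>\<open>True\<close> is the
  preserved (open) channel 1 and \<^const>\<open>False\<close> the closed channel 0.  \<open>belief_update r m y s\<close> is the
  belief at review \<open>r + 1\<close> after observing the served demand \<open>s\<close> under the capacity limit \<open>y\<close>,
  starting from the belief \<open>m\<close>.
\<close>

record response_problem =
  horizon :: nat
  belief_set :: "nat \<Rightarrow> real set"
  demand_law :: "nat \<Rightarrow> real \<Rightarrow> real measure"
  belief_update :: "nat \<Rightarrow> real \<Rightarrow> real \<Rightarrow> real \<Rightarrow> real"
  next_capacity :: "nat \<Rightarrow> real \<Rightarrow> real \<Rightarrow> real"
  max_deployment :: "nat \<Rightarrow> real"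
  unit_cost :: "nat \<Rightarrow> real"
  readiness_cost :: "nat \<Rightarrow> real"
  holding_cost :: real
  shortage_cost :: real

definition feasible :: "response_problem \<Rightarrow> nat \<Rightarrow> real set" where
  "feasible P r = {0..max_deployment P r}"

definition operating_cost :: "response_problem \<Rightarrow> real \<Rightarrow> real \<Rightarrow> real \<Rightarrow> real" where
  "operating_cost P I q d =
     holding_cost P * max (I + q - d) 0 + shortage_cost P * max (d - I - q) 0"

definition next_belief :: "response_problem \<Rightarrow> nat \<Rightarrow> real \<Rightarrow> real \<Rightarrow> real \<Rightarrow> real \<Rightarrow> real" where
  "next_belief P r m I q d = belief_update P r m (I + q) (min d (I + q))"

text \<open>\<open>W\<close> is a value function for the next review, with arguments belief and capacity.\<close>

definition expected_cost ::
  "response_problem \<Rightarrow> nat \<Rightarrow> (real \<Rightarrow> real \<Rightarrow> real) \<Rightarrow> real \<Rightarrow> real \<Rightarrow> real \<Rightarrow> real" where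
  "expected_cost P r W q m I =
     (\<integral>d. operating_cost P I q d + W (next_belief P r m I q d) (next_capacity P r I q)
        \<partial>demand_law P r m)"

text \<open>
  The minima over deployments are written as infima; under the regularity conditions below they
  are attained.
\<close>

function value_fun :: "response_problem \<Rightarrow> nat \<Rightarrow> bool \<Rightarrow> real \<Rightarrow> real \<Rightarrow> real" where
  "value_fun P r =
     (if r > horizon P then (\<lambda>a m I. 0)
      else (\<lambda>a m I.
        if a then
          min (INF q\<in>feasible P r.
                 unit_cost P r * q + expected_cost P r (value_fun P (Suc r) False) q m I)
              (readiness_cost P r +
                (INF q\<in>feasible P r.
                   unit_cost P r * q + expected_cost P r (value_fun P (Suc r) True) q m I))
        else expected_cost P r (value_fun P (Suc r) False) 0 m I))"
  by pat_completeness auto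
termination
  by (relation "Wellfounded.measure (\<lambda>(P, r). Suc (horizon P) - r)") auto

declare value_fun.simps [simp del]

definition objective ::
  "response_problem \<Rightarrow> nat \<Rightarrow> bool \<Rightarrow> real \<Rightarrow> real \<Rightarrow> real \<Rightarrow> real" where
  "objective P r a q m I =
     unit_cost P r * q + expected_cost P r (value_fun P (Suc r) a) q m I"

definition cond_value :: "response_problem \<Rightarrow> nat \<Rightarrow> bool \<Rightarrow> real \<Rightarrow> real \<Rightarrow> real" where
  "cond_value P r a m I = (INF q\<in>feasible P r. objective P r a q m I)"

definition smallest_optimizer :: "response_problem \<Rightarrow> nat \<Rightarrow> bool \<Rightarrow> real \<Rightarrow> real \<Rightarrow> real" where
  "smallest_optimizer P r a m I =
     (LEAST q. is_arg_min (\<lambda>q. objective P r a q m I) (\<lambda>q. q \<in> feasible P r) q)"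

definition preservation_value :: "response_problem \<Rightarrow> nat \<Rightarrow> real \<Rightarrow> real \<Rightarrow> real" where
  "preservation_value P r m I = cond_value P r False m I - cond_value P r True m I"

definition marginal_value :: "response_problem \<Rightarrow> nat \<Rightarrow> bool \<Rightarrow> real \<Rightarrow> real \<Rightarrow> real" where
  "marginal_value P r a m I =
     (THE D. ((\<lambda>q. objective P r a q m I) has_real_derivative D) (at_right 0))"

lemma value_fun_terminal: "r > horizon P \<Longrightarrow> value_fun P r a m I = 0"
  by (subst value_fun.simps) simp

lemma value_fun_closed:
  "r \<le> horizon P \<Longrightarrow>
     value_fun P r False m I = expected_cost P r (value_fun P (Suc r) False) 0 m I"
  by (subst value_fun.simps) simp

lemma value_fun_open:
  "r \<le> horizon P \<Longrightarrow>
     value_fun P r True m I =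
       min (cond_value P r False m I) (readiness_cost P r + cond_value P r True m I)"
  by (subst value_fun.simps) (simp add: cond_value_def objective_def)

definition optimal_action ::
  "response_problem \<Rightarrow> nat \<Rightarrow> real \<Rightarrow> real \<Rightarrow> real \<Rightarrow> bool \<Rightarrow> bool" where
  "optimal_action P r m I q a \<longleftrightarrow>
     is_arg_min (\<lambda>(q, a). objective P r a q m I + readiness_cost P r * of_bool a)
       (\<lambda>x. x \<in> feasible P r \<times> UNIV) (q, a)"

datatype action_mode = Exit | Standby | Terminal_Response | Sustained_Response

definition mode_of :: "real \<Rightarrow> bool \<Rightarrow> action_mode" where
  "mode_of q a =
     (if q > 0 then (if a then Sustained_Response else Terminal_Response)
      else (if a then Standby else Exit))"

definition is_preservation_threshold ::
  "response_problem \<Rightarrow> nat \<Rightarrow> real \<Rightarrow> real \<Rightarrow> bool" where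
  "is_preservation_threshold P r I m \<longleftrightarrow>
     m \<in> belief_set P r \<and> preservation_value P r m I = readiness_cost P r"

definition is_deployment_threshold ::
  "response_problem \<Rightarrow> nat \<Rightarrow> bool \<Rightarrow> real \<Rightarrow> real \<Rightarrow> bool" where
  "is_deployment_threshold P r a I m \<longleftrightarrow>
     m \<in> belief_set P r \<and> marginal_value P r a m I = 0"

definition preservation_threshold :: "response_problem \<Rightarrow> nat \<Rightarrow> real \<Rightarrow> real" where
  "preservation_threshold P r I = (THE m. is_preservation_threshold P r I m)"

definition deployment_threshold :: "response_problem \<Rightarrow> nat \<Rightarrow> bool \<Rightarrow> real \<Rightarrow> real" where
  "deployment_threshold P r a I = (THE m. is_deployment_threshold P r a I m)"

definition with_readiness_cost ::
  "response_problem \<Rightarrow> nat \<Rightarrow> real \<Rightarrow> response_problem" where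
  "with_readiness_cost P r \<kappa> = P\<lparr>readiness_cost := (readiness_cost P)(r := \<kappa>)\<rparr>"

definition lsc_on :: "real set \<Rightarrow> (real \<Rightarrow> real) \<Rightarrow> bool" where
  "lsc_on S f \<longleftrightarrow> (\<forall>x\<in>S. \<forall>y<f x. \<forall>\<^sub>F z in at x within S. y < f z)"

text \<open>
  The standing conditions of the model.  Nonnegativity of demand is carried by the law living on
  \<open>{0..}\<close>; the two integrability conditions make every Bellman expectation finite, which matters
  because the integral of a non-integrable function is \<open>0\<close>.
\<close>

locale response_model =
  fixes P :: response_problem
  assumes belief_interval:
      "r \<in> {1..horizon P} \<Longrightarrow> is_interval (belief_set P r)"
    and demand_kernel:
      "r \<in> {1..horizon P} \<Longrightarrow>
         demand_law P r \<in> restrict_space borel (belief_set P r) \<rightarrow>\<^sub>M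
           prob_algebra (restrict_space borel {0..})"
    and belief_transition:
      "r \<in> {1..<horizon P} \<Longrightarrow>
         (\<lambda>(m, y, s). belief_update P r m y s)
           \<in> restrict_space borel {(m, y, s). m \<in> belief_set P r \<and> 0 \<le> s \<and> s \<le> y} \<rightarrow>\<^sub>M
             restrict_space borel (belief_set P (Suc r))"
    and capacity_transition:
      "r \<in> {1..<horizon P} \<Longrightarrow>
         (\<lambda>(I, q). next_capacity P r I q)
           \<in> restrict_space borel ({0..} \<times> feasible P r) \<rightarrow>\<^sub>M restrict_space borel {0..}"
    and max_deployment_nonneg:
      "r \<in> {1..horizon P} \<Longrightarrow> 0 \<le> max_deployment P r"
    and operating_costs_nonneg:
      "0 \<le> holding_cost P" "0 \<le> shortage_cost P"
    and operating_cost_integrable: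
      "\<lbrakk>r \<in> {1..horizon P}; m \<in> belief_set P r; 0 \<le> I; q \<in> feasible P r\<rbrakk> \<Longrightarrow>
         integrable (demand_law P r m) (operating_cost P I q)"
    and value_integrable:
      "\<lbrakk>r \<in> {1..horizon P}; m \<in> belief_set P r; 0 \<le> I; q \<in> feasible P r\<rbrakk> \<Longrightarrow>
         integrable (demand_law P r m)
           (\<lambda>d. value_fun P (Suc r) a (next_belief P r m I q d) (next_capacity P r I q))"
    and objective_lsc:
      "\<lbrakk>r \<in> {1..horizon P}; m \<in> belief_set P r; 0 \<le> I\<rbrakk> \<Longrightarrow>
         lsc_on (feasible P r) (\<lambda>q. objective P r a q m I)"

end

theory Submission
  imports Defs
begin

text \<open>
  Decreasing differences make the smallest optimizer monotone (Topkis).  By convexity the sign of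
  the marginal value at zero decides whether zero is optimal, so strict monotonicity of the
  marginal value yields one deployment boundary per channel side; the sign of the preservation
  value minus the readiness cost decides which side is optimal.  Both depend on the future only
  through the value functions at later reviews, which do not see the current readiness cost.
\<close>

section \<open>Right derivatives and convexity\<close>

text \<open>Limits along a nontrivial filter are unique. This gives the \<open>THE\<close> in
  \<open>marginal_value\<close> its meaning, since \<open>at_right 0\<close> is nontrivial.\<close>

lemma has_real_derivative_within_unique:
  fixes f :: "real \<Rightarrow> real"
  assumes "(f has_real_derivative D) (at x within S)" "(f has_real_derivative E) (at x within S)"
    and "at x within S \<noteq> bot"
  shows "D = E"
  using assms tendsto_unique unfolding has_field_derivative_iff by blast

text \<open>Convexity makes the secant slope from \<open>x\<close> increase with its right endpoint,
  so its limit \<open>D\<close> at \<open>x\<close> is at most the slope to \<open>y\<close>: the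
  graph lies above its right tangent line.\<close>

lemma convex_on_right_derivative_le:
  fixes f :: "real \<Rightarrow> real"
  assumes f: "convex_on {x..b} f" and D: "(f has_real_derivative D) (at_right x)"
    and y: "x \<le> y" "y \<le> b"
  shows "f x + D * (y - x) \<le> f y"
proof (cases "y = x")
  case False
  with y have "x < y" by simp
  have "\<forall>\<^sub>F t in at_right x. x < t \<and> t < y"
    using eventually_at_right_less \<open>x < y\<close> eventually_at_right_real[of x y] by simp
  then have "\<forall>\<^sub>F t in at_right x. (f t - f x) / (t - x) \<le> (f y - f x) / (y - x)"
  proof eventually_elim
    case (elim t)
    \<comment> \<open>The weight that writes \<open>t\<close> as a convex combination of
      \<open>x\<close> and \<open>y\<close>.\<close>
    define u where "u = (t - x) / (y - x)"
    have u: "0 \<le> u" "u \<le> 1"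
      using elim by (auto simp: u_def field_simps)
    have "u * (y - x) = t - x"
      using elim by (simp add: u_def)
    then have t: "t = (1 - u) * x + u * y"
      by (simp add: algebra_simps)
    have "f t \<le> (1 - u) * f x + u * f y"
      using convex_onD[OF f u(1,2), of x y] y t by simp
    then have "f t - f x \<le> (t - x) / (y - x) * (f y - f x)"
      by (simp add: u_def[symmetric] algebra_simps)
    then show ?case
      using elim by (simp add: field_simps)
  qed
  then have "D \<le> (f y - f x) / (y - x)"
    by (intro tendsto_upperbound[OF D[unfolded has_field_derivative_iff]]) auto
  then show ?thesis
    using \<open>x < y\<close> by (simp add: field_simps)
qed simp

section \<open>Attained minima and least minimizers\<close>

lemma is_arg_min_iff:
  fixes f :: "'a \<Rightarrow> 'b::linorder"
  shows "is_arg_min f (\<lambda>x. x \<in> S) x \<longleftrightarrow> x \<in> S \<and> (\<forall>y\<in>S. f x \<le> f y)"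
  by (auto simp: is_arg_min_linorder)

lemma Inf_eq_arg_min:
  fixes f :: "'a \<Rightarrow> real"
  assumes "is_arg_min f (\<lambda>x. x \<in> S) x"
  shows "(INF y\<in>S. f y) = f x"
  using assms by (auto simp: is_arg_min_iff intro!: cInf_eq_minimum)

text \<open>On the reals \<open>LEAST\<close> is informative only once a least element is exhibited.
  The minimizers form a closed subset of a compact set, so they have one.\<close>

lemma Least_is_arg_min:
  fixes f :: "real \<Rightarrow> real"
  assumes "compact S" "S \<noteq> {}" "continuous_on S f"
  defines "M \<equiv> is_arg_min f (\<lambda>x. x \<in> S)"
  shows "M (LEAST x. M x)" "M x \<Longrightarrow> (LEAST x. M x) \<le> x"
proof -
  obtain z where z: "z \<in> S" "\<And>y. y \<in> S \<Longrightarrow> f z \<le> f y"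
    using continuous_attains_inf[OF assms(1-3)] by blast
  \<comment> \<open>The minimizers are the sublevel set at the minimum value \<open>f z\<close>,
    which is closed by continuity.\<close>
  have M: "Collect M = S \<inter> f -` {..f z}"
    using z by (fastforce simp: M_def is_arg_min_iff)
  have "closed (Collect M)"
    unfolding M using assms(1,3) by (intro continuous_closed_preimage) (auto dest: compact_imp_closed)
  moreover have "Collect M = S \<inter> Collect M"
    by (auto simp: M_def is_arg_min_iff)
  ultimately have "compact (Collect M)"
    using compact_Int_closed[OF assms(1)] by metis
  moreover have "z \<in> Collect M"
    using z by (simp add: M_def is_arg_min_iff)
  ultimately obtain w where w: "M w" "\<And>y. M y \<Longrightarrow> w \<le> y"
    using compact_attains_inf[of "Collect M"] by blast
  then have "(LEAST x. M x) = w"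
    by (intro Least_equality)
  with w show "M (LEAST x. M x)" "M x \<Longrightarrow> (LEAST x. M x) \<le> x"
    by auto
qed

section \<open>Splitting the choice of quantity and channel\<close>

text \<open>The joint minimum can be taken first over quantities on each channel side and then over
  the two sides. Attainment turns the infima into objective values at minimizers \<open>z a\<close>,
  so comparing the sides amounts to comparing the preservation value with the readiness
  cost.\<close>

lemma optimal_action_iff:
  assumes "\<And>a. \<exists>q. is_arg_min (\<lambda>q. objective P r a q m I) (\<lambda>q. q \<in> feasible P r) q"
  shows "optimal_action P r m I q a \<longleftrightarrow>
    is_arg_min (\<lambda>q. objective P r a q m I) (\<lambda>q. q \<in> feasible P r) q \<and>
    (if a then readiness_cost P r \<le> preservation_value P r m I
     else preservation_value P r m I \<le> readiness_cost P r)"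
proof -
  let ?M = "\<lambda>a. is_arg_min (\<lambda>q. objective P r a q m I) (\<lambda>q. q \<in> feasible P r)"
  obtain z where z: "?M a (z a)" for a
    using assms by metis
  have v: "cond_value P r a m I = objective P r a (z a) m I" for a
    unfolding cond_value_def by (rule Inf_eq_arg_min[OF z])
  have opt: "optimal_action P r m I q a \<longleftrightarrow> q \<in> feasible P r \<and>
      (\<forall>q'\<in>feasible P r. \<forall>a'. objective P r a q m I + readiness_cost P r * of_bool a
         \<le> objective P r a' q' m I + readiness_cost P r * of_bool a')"
    unfolding optimal_action_def is_arg_min_linorder by auto
  have zmin: "z a \<in> feasible P r" "q \<in> feasible P r \<Longrightarrow> objective P r a (z a) m I \<le> objective P r a q m I"
    for a q using z[of a] by (auto simp: is_arg_min_iff)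
  show ?thesis
  proof
    assume L: "optimal_action P r m I q a"
    then have q: "q \<in> feasible P r" and le: "\<And>q' a'. q' \<in> feasible P r \<Longrightarrow>
        objective P r a q m I + readiness_cost P r * of_bool a
         \<le> objective P r a' q' m I + readiness_cost P r * of_bool a'"
      by (auto simp: opt)
    have "?M a q"
      using q le[of _ a] by (auto simp: is_arg_min_iff)
    moreover have "if a then readiness_cost P r \<le> preservation_value P r m I
        else preservation_value P r m I \<le> readiness_cost P r"
      \<comment> \<open>The chosen action is compared with the best quantity on the opposite side,
        while \<open>z a\<close> bounds its own objective from below.\<close>
      using le[OF zmin(1), of "\<not> a" "\<not> a"] zmin(2)[OF q, of a]
      by (cases a) (auto simp: preservation_value_def v)
    ultimately show "?M a q \<and> (if a then readiness_cost P r \<le> preservation_value P r m I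
        else preservation_value P r m I \<le> readiness_cost P r)" ..
  next
    assume R: "?M a q \<and> (if a then readiness_cost P r \<le> preservation_value P r m I
        else preservation_value P r m I \<le> readiness_cost P r)"
    then have q: "q \<in> feasible P r" and le: "objective P r a q m I \<le> objective P r a (z a) m I"
      using zmin by (auto simp: is_arg_min_iff)
    have "objective P r a q m I + readiness_cost P r * of_bool a
         \<le> objective P r a' q' m I + readiness_cost P r * of_bool a'"
      if "q' \<in> feasible P r" for q' a'
      using le zmin(2)[OF that, of a'] R
      by (cases a; cases a') (auto simp: preservation_value_def v)
    with q show "optimal_action P r m I q a"
      by (simp add: opt)
  qed
qed

section \<open>Monotone smallest optimizer\<close>

text \<open>If the optimizer fell as the belief rose, the larger quantity \<open>?q\<close> would
  strictly beat \<open>?q'\<close> at \<open>m\<close>, and decreasing differences would carry this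
  advantage to \<open>m'\<close>, where \<open>?q'\<close> is optimal.\<close>

lemma smallest_optimizer_mono:
  assumes "compact (feasible P r)" "feasible P r \<noteq> {}"
    and cont: "\<And>m. m \<in> B \<Longrightarrow> continuous_on (feasible P r) (\<lambda>q. objective P r a q m I)"
    and dd: "\<And>q q'. \<lbrakk>q \<in> feasible P r; q' \<in> feasible P r; q \<le> q'\<rbrakk> \<Longrightarrow>
         antimono_on B (\<lambda>m. objective P r a q' m I - objective P r a q m I)"
  shows "mono_on B (\<lambda>m. smallest_optimizer P r a m I)"
proof (rule mono_onI, rule ccontr)
  fix m m' assume m: "m \<in> B" "m' \<in> B" "m \<le> m'"
  let ?q = "smallest_optimizer P r a m I" and ?q' = "smallest_optimizer P r a m' I"
  note L = Least_is_arg_min[OF assms(1,2) cont, folded smallest_optimizer_def]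
  assume "\<not> ?q \<le> ?q'"
  then have less: "?q' < ?q" by simp
  have q: "?q \<in> feasible P r" "\<And>y. y \<in> feasible P r \<Longrightarrow> objective P r a ?q m I \<le> objective P r a y m I"
    and q': "?q' \<in> feasible P r" "\<And>y. y \<in> feasible P r \<Longrightarrow> objective P r a ?q' m' I \<le> objective P r a y m' I"
    using L(1)[of m] L(1)[of m'] m by (auto simp: is_arg_min_iff)
  \<comment> \<open>Being below the smallest minimizer at \<open>m\<close>, \<open>?q'\<close>
    cannot minimize there; this makes the next inequality strict.\<close>
  have "\<not> is_arg_min (\<lambda>q. objective P r a q m I) (\<lambda>q. q \<in> feasible P r) ?q'"
    using L(2)[of m ?q'] m less by auto
  then have "objective P r a ?q m I < objective P r a ?q' m I"
    using q q'(1) unfolding is_arg_min_iff by (meson leI order_trans)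
  moreover have "objective P r a ?q m' I - objective P r a ?q' m' I
      \<le> objective P r a ?q m I - objective P r a ?q' m I"
    using monotone_onD[OF dd[OF q'(1) q(1)] m] less by simp
  ultimately show False
    using q'(2)[OF q(1)] by simp
qed

section \<open>Marginal value at zero and the deployment decision\<close>

lemma has_marginal_value:
  assumes "\<exists>D. ((\<lambda>q. objective P r a q m I) has_real_derivative D) (at_right 0)"
  shows "((\<lambda>q. objective P r a q m I) has_real_derivative marginal_value P r a m I) (at_right 0)"
  unfolding marginal_value_def
  by (rule theI') (use assms in \<open>auto intro: has_real_derivative_within_unique\<close>)

text \<open>The tangent line at zero bounds the convex objective from below and has nonnegative
  slope.\<close>

lemma zero_arg_min:
  assumes conv: "convex_on (feasible P r) (\<lambda>q. objective P r a q m I)"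
    and ex: "\<exists>D. ((\<lambda>q. objective P r a q m I) has_real_derivative D) (at_right 0)"
    and "0 < max_deployment P r" "0 \<le> marginal_value P r a m I"
  shows "is_arg_min (\<lambda>q. objective P r a q m I) (\<lambda>q. q \<in> feasible P r) 0"
proof -
  have "objective P r a 0 m I \<le> objective P r a q m I" if "q \<in> feasible P r" for q
  proof -
    have "objective P r a 0 m I + marginal_value P r a m I * (q - 0) \<le> objective P r a q m I"
      using convex_on_right_derivative_le[OF conv[unfolded feasible_def] has_marginal_value[OF ex]]
        that by (simp add: feasible_def)
    moreover have "0 \<le> marginal_value P r a m I * (q - 0)"
      using assms(4) that by (simp add: feasible_def)
    ultimately show ?thesis by linarith
  qed
  with assms(3) show ?thesis
    unfolding is_arg_min_iff by (simp add: feasible_def)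
qed

text \<open>A tangent line of strictly positive slope rules out every positive quantity. With slope
  zero positive quantities may tie, which is where a tie rule enters.\<close>

lemma arg_min_eq_zero:
  assumes conv: "convex_on (feasible P r) (\<lambda>q. objective P r a q m I)"
    and ex: "\<exists>D. ((\<lambda>q. objective P r a q m I) has_real_derivative D) (at_right 0)"
    and pos: "0 < marginal_value P r a m I"
    and q: "is_arg_min (\<lambda>q. objective P r a q m I) (\<lambda>q. q \<in> feasible P r) q"
  shows "q = 0"
proof (rule ccontr)
  assume "q \<noteq> 0"
  with q have "0 < q" "q \<le> max_deployment P r"
    unfolding is_arg_min_iff by (auto simp: feasible_def)
  moreover from this have "objective P r a 0 m I + marginal_value P r a m I * (q - 0) \<le> objective P r a q m I"
    by (intro convex_on_right_derivative_le[OF conv[unfolded feasible_def] has_marginal_value[OF ex]]) auto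
  moreover have "0 < marginal_value P r a m I * (q - 0)"
    using pos \<open>0 < q\<close> by simp
  moreover have "objective P r a q m I \<le> objective P r a 0 m I"
    using q calculation(1,2) unfolding is_arg_min_iff by (auto simp: feasible_def)
  ultimately show False by linarith
qed

text \<open>A negative right derivative makes some small positive quantity strictly cheaper than
  zero.\<close>

lemma arg_min_pos:
  assumes ex: "\<exists>D. ((\<lambda>q. objective P r a q m I) has_real_derivative D) (at_right 0)"
    and neg: "marginal_value P r a m I < 0" and b: "0 < max_deployment P r"
    and q: "is_arg_min (\<lambda>q. objective P r a q m I) (\<lambda>q. q \<in> feasible P r) q"
  shows "0 < q"
proof (rule ccontr)
  assume "\<not> 0 < q"
  with q have "q = 0"
    unfolding is_arg_min_iff by (auto simp: feasible_def)
  obtain d where d: "0 < d" "\<And>h. \<lbrakk>0 < h; 0 + h \<in> {0<..}; h < d\<rbrakk> \<Longrightarrow>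
      objective P r a (0 + h) m I < objective P r a 0 m I"
    using has_real_derivative_neg_dec_right[OF has_marginal_value[OF ex] neg] by blast
  \<comment> \<open>Halving \<open>d\<close> keeps \<open>h\<close> strictly inside the range of
    decrease; the other bound keeps it feasible.\<close>
  define h where "h = min (d / 2) (max_deployment P r)"
  have "objective P r a h m I < objective P r a 0 m I" "h \<in> feasible P r"
    using d(2)[of h] d(1) b by (auto simp: h_def feasible_def)
  with q \<open>q = 0\<close> show False
    by (auto simp: is_arg_min_iff)
qed

section \<open>Effect of the current readiness cost\<close>

lemma with_readiness_cost_simps [simp]:
  "feasible (with_readiness_cost P r \<kappa>) = feasible P"
  "belief_set (with_readiness_cost P r \<kappa>) = belief_set P"
  "unit_cost (with_readiness_cost P r \<kappa>) = unit_cost P"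
  "horizon (with_readiness_cost P r \<kappa>) = horizon P"
  "readiness_cost (with_readiness_cost P r \<kappa>) = (readiness_cost P)(r := \<kappa>)"
  "expected_cost (with_readiness_cost P r \<kappa>) = expected_cost P"
  by (auto simp: with_readiness_cost_def feasible_def expected_cost_def operating_cost_def
      next_belief_def fun_eq_iff)

text \<open>Backward induction from the horizon: the recursion at \<open>s\<close> reads readiness
  costs only at \<open>s\<close> and later, past the altered entry \<open>r\<close>.\<close>

lemma value_fun_with_readiness_cost:
  "r < s \<Longrightarrow> value_fun (with_readiness_cost P r \<kappa>) s = value_fun P s"
proof (induction "Suc (horizon P) - s" arbitrary: s rule: less_induct)
  case less
  show ?case
  proof (cases "horizon P < s")
    case True
    then show ?thesis
      by (intro ext) (simp add: value_fun_terminal)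
  next
    case False
    then have "value_fun (with_readiness_cost P r \<kappa>) (Suc s) = value_fun P (Suc s)"
      using less.prems by (intro less.hyps) auto
    with False less.prems show ?thesis
      \<comment> \<open>\<open>if_cong\<close> lets the induction step rewrite inside the branches
        of the undecided \<open>if a\<close>.\<close>
      by (subst (1 2) value_fun.simps) (simp cong: if_cong)
  qed
qed

text \<open>The objective at \<open>r\<close> sees value functions only at \<open>Suc r\<close>; the
  readiness cost at \<open>r\<close> is added outside it.\<close>

lemma objective_with_readiness_cost [simp]:
  "objective (with_readiness_cost P r \<kappa>) r = objective P r"
  by (intro ext) (simp add: objective_def value_fun_with_readiness_cost)

lemma marginal_value_with_readiness_cost [simp]:
  "marginal_value (with_readiness_cost P r \<kappa>) r = marginal_value P r"
  by (intro ext) (simp add: marginal_value_def)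

lemma preservation_value_with_readiness_cost [simp]:
  "preservation_value (with_readiness_cost P r \<kappa>) r = preservation_value P r"
  by (intro ext) (simp add: preservation_value_def cond_value_def)

section \<open>Existence and uniqueness of crossings\<close>

text \<open>The intermediate value theorem gives a solution in \<open>{lo..hi}\<close>. Monotonicity
  on \<open>B\<close> confines all solutions to that interval, where strict monotonicity leaves only
  one.\<close>

lemma ex1_crossing:
  fixes g :: "real \<Rightarrow> real"
  assumes "is_interval B" "continuous_on B g" "mono_on B g"
    and "lo \<in> B" "hi \<in> B" "lo < hi" "g lo < k" "k < g hi" "strict_mono_on {lo..hi} g"
  shows "\<exists>!m. m \<in> B \<and> g m = k"
proof -
  have sub: "{lo..hi} \<subseteq> B"
    using mem_is_interval_1_I[OF assms(1,4,5)] by auto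
  obtain m where m: "lo \<le> m" "m \<le> hi" "g m = k"
    using IVT'[of g lo k hi] assms(6-8) continuous_on_subset[OF assms(2) sub] by auto
  have "x \<in> {lo..hi}" if "x \<in> B" "g x = k" for x
    using that assms(4,5,7,8) mono_onD[OF assms(3), of x lo] mono_onD[OF assms(3), of hi x]
    by (simp, linarith)
  with m sub show ?thesis
    using inj_onD[OF strict_mono_on_imp_inj_on[OF assms(9)]]
    by (intro ex1I[of _ m]) auto
qed

text \<open>The previous crossing result applied to \<open>- g\<close> at level zero.\<close>

lemma ex1_zero_strict_antimono:
  fixes g :: "real \<Rightarrow> real"
  assumes "is_interval B" "continuous_on B g" "strict_antimono_on B g"
    and "lo \<in> B" "hi \<in> B" "lo < hi" "0 < g lo" "g hi < 0"
  shows "\<exists>!m. m \<in> B \<and> g m = 0"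
proof -
  have sub: "{lo..hi} \<subseteq> B"
    using mem_is_interval_1_I[OF assms(1,4,5)] by auto
  have sm: "strict_mono_on B (\<lambda>m. - g m)"
    using assms(3) by (auto simp: monotone_on_def)
  have "\<exists>!m. m \<in> B \<and> - g m = 0"
    using assms(1,4-8) continuous_on_minus[OF assms(2)] strict_mono_on_imp_mono_on[OF sm]
      monotone_on_subset[OF sm sub]
    by (intro ex1_crossing[where lo = lo and hi = hi]) simp_all
  then show ?thesis by simp
qed

section \<open>Thresholds and optimal modes\<close>

theorem proposition1:
  fixes P :: response_problem and r :: nat and I :: real
  assumes model: "response_model P"
    and epoch: "1 \<le> r" "r < horizon P"
    and capacity: "0 \<le> I"
    and A1_deployable: "0 < max_deployment P r"
    and A1_continuous:
      "\<And>a. continuous_on (feasible P r \<times> belief_set P r) (\<lambda>(q, m). objective P r a q m I)"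
    and A1_convex:
      "\<And>a m. m \<in> belief_set P r \<Longrightarrow> convex_on (feasible P r) (\<lambda>q. objective P r a q m I)"
    and A1_decreasing_differences:
      "\<And>a q q'. \<lbrakk>q \<in> feasible P r; q' \<in> feasible P r; q \<le> q'\<rbrakk> \<Longrightarrow>
         antimono_on (belief_set P r) (\<lambda>m. objective P r a q' m I - objective P r a q m I)"
    and A1_marginal_exists:
      "\<And>a m. m \<in> belief_set P r \<Longrightarrow>
         (\<exists>D. ((\<lambda>q. objective P r a q m I) has_real_derivative D) (at_right 0))"
    and A1_marginal_continuous:
      "\<And>a. continuous_on (belief_set P r) (\<lambda>m. marginal_value P r a m I)"
    and A1_marginal_decreasing:
      "\<And>a. strict_antimono_on (belief_set P r) (\<lambda>m. marginal_value P r a m I)"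
    and A2:
      "continuous_on (belief_set P r) (\<lambda>m. preservation_value P r m I)"
      "mono_on (belief_set P r) (\<lambda>m. preservation_value P r m I)"
    and A3_preservation:
      "\<exists>lo\<in>belief_set P r. \<exists>hi\<in>belief_set P r. lo < hi \<and>
         preservation_value P r lo I < readiness_cost P r \<and>
         readiness_cost P r < preservation_value P r hi I \<and>
         strict_mono_on {lo..hi} (\<lambda>m. preservation_value P r m I)"
    and A3_deployment:
      "\<And>a. \<exists>lo\<in>belief_set P r. \<exists>hi\<in>belief_set P r. lo < hi \<and>
         marginal_value P r a lo I > 0 \<and> 0 > marginal_value P r a hi I"
  shows
    "(\<forall>a. mono_on (belief_set P r) (\<lambda>m. smallest_optimizer P r a m I))
   \<and> ((\<exists>!m. is_preservation_threshold P r I m)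
      \<and> (\<exists>!m. is_deployment_threshold P r False I m)
      \<and> (\<exists>!m. is_deployment_threshold P r True I m))
   \<and> (\<forall>m\<in>belief_set P r.
        let mP = preservation_threshold P r I;
            mD = (\<lambda>a. deployment_threshold P r a I);
            selected = (\<lambda>q a. optimal_action P r m I q a
                          \<and> (m = mP \<longrightarrow> \<not> a) \<and> (m = mD a \<longrightarrow> q = 0))
        in (\<exists>q a. selected q a)
           \<and> (\<forall>q a. selected q a \<longrightarrow>
                (m \<le> mP \<and> m \<le> mD False \<longrightarrow> mode_of q a = Exit)
              \<and> (m \<le> mP \<and> m > mD False \<longrightarrow> mode_of q a = Terminal_Response)
              \<and> (m > mP \<and> m \<le> mD True \<longrightarrow> mode_of q a = Standby)
              \<and> (m > mP \<and> m > mD True \<longrightarrow> mode_of q a = Sustained_Response)))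
   \<and> ((\<forall>\<kappa> \<kappa>' m m'. \<kappa> < \<kappa>'
          \<and> is_preservation_threshold (with_readiness_cost P r \<kappa>) r I m
          \<and> is_preservation_threshold (with_readiness_cost P r \<kappa>') r I m'
          \<longrightarrow> m < m')
      \<and> (\<forall>\<kappa> a m. is_deployment_threshold (with_readiness_cost P r \<kappa>) r a I m
                  \<longleftrightarrow> is_deployment_threshold P r a I m))"
proof (intro conjI)
  interpret response_model P by (rule model)
  define B where "B = belief_set P r"
  let ?G = "\<lambda>m. preservation_value P r m I" and ?\<psi> = "\<lambda>a m. marginal_value P r a m I"
  let ?M = "\<lambda>a m. is_arg_min (\<lambda>q. objective P r a q m I) (\<lambda>q. q \<in> feasible P r)"
  have interval: "is_interval B"
    unfolding B_def using epoch by (intro belief_interval) simp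
  have feas: "compact (feasible P r)" "feasible P r \<noteq> {}"
    using A1_deployable by (auto simp: feasible_def)
  have cont: "continuous_on (feasible P r) (\<lambda>q. objective P r a q m I)" if "m \<in> B" for a m
  proof -
    have "continuous_on (feasible P r) (\<lambda>q. (q, m))"
      by (intro continuous_intros)
    moreover have "(\<lambda>q. (q, m)) ` feasible P r \<subseteq> feasible P r \<times> belief_set P r"
      using that by (auto simp: B_def)
    ultimately show ?thesis
      using continuous_on_compose2[OF A1_continuous[of a], of _ "\<lambda>q. (q, m)"] by simp
  qed
  show "\<forall>a. mono_on (belief_set P r) (\<lambda>m. smallest_optimizer P r a m I)"
    using smallest_optimizer_mono[OF feas cont[unfolded B_def] A1_decreasing_differences] by blast
  have ex1P: "\<exists>!m. is_preservation_threshold P r I m"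
  proof -
    obtain lo hi where "lo \<in> B" "hi \<in> B" "lo < hi" "?G lo < readiness_cost P r"
        "readiness_cost P r < ?G hi" "strict_mono_on {lo..hi} ?G"
      using A3_preservation unfolding B_def by blast
    from ex1_crossing[OF interval A2[folded B_def] this] show ?thesis
      by (simp add: is_preservation_threshold_def B_def)
  qed
  have ex1D: "\<exists>!m. is_deployment_threshold P r a I m" for a
  proof -
    obtain lo hi where "lo \<in> B" "hi \<in> B" "lo < hi" "0 < ?\<psi> a lo" "?\<psi> a hi < 0"
      using A3_deployment[of a] unfolding B_def by blast
    from ex1_zero_strict_antimono[OF interval A1_marginal_continuous[folded B_def]
        A1_marginal_decreasing[folded B_def] this]
    show ?thesis
      by (simp add: is_deployment_threshold_def B_def)
  qed
  show "\<exists>!m. is_preservation_threshold P r I m" "\<exists>!m. is_deployment_threshold P r False I m"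
      "\<exists>!m. is_deployment_threshold P r True I m"
    by (fact ex1P ex1D)+

  define mP where "mP = preservation_threshold P r I"
  define mD where "mD a = deployment_threshold P r a I" for a
  have mP: "mP \<in> B" "?G mP = readiness_cost P r"
      and mP_unique: "\<And>m. \<lbrakk>m \<in> B; ?G m = readiness_cost P r\<rbrakk> \<Longrightarrow> m = mP"
  proof -
    have "is_preservation_threshold P r I mP"
      unfolding mP_def preservation_threshold_def by (rule theI'[OF ex1P])
    then show "mP \<in> B" "?G mP = readiness_cost P r"
      by (simp_all add: is_preservation_threshold_def B_def)
    show "m = mP" if "m \<in> B" "?G m = readiness_cost P r" for m
      using the1_equality[OF ex1P, of m] that
      by (simp add: mP_def preservation_threshold_def is_preservation_threshold_def B_def)
  qed
  have mD: "mD a \<in> B" "?\<psi> a (mD a) = 0" for a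
  proof -
    have "is_deployment_threshold P r a I (mD a)"
      unfolding mD_def deployment_threshold_def by (rule theI'[OF ex1D])
    then show "mD a \<in> B" "?\<psi> a (mD a) = 0"
      by (simp_all add: is_deployment_threshold_def B_def)
  qed
  \<comment> \<open>Monotonicity of \<open>?G\<close> gives only a weak inequality; uniqueness of
    the threshold excludes equality. The same holds above \<open>mP\<close>.\<close>
  have G_less: "?G m < readiness_cost P r" if "m \<in> B" "m < mP" for m
    using mono_onD[OF A2(2), of m mP] mP mP_unique[of m] that by (force simp: B_def)
  have G_greater: "readiness_cost P r < ?G m" if "m \<in> B" "mP < m" for m
    using mono_onD[OF A2(2), of mP m] mP mP_unique[of m] that by (force simp: B_def)
  have \<psi>_pos: "0 < ?\<psi> a m" if "m \<in> B" "m < mD a" for a m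
    using monotone_onD[OF A1_marginal_decreasing[of a], of m "mD a"] mD[of a] that by (simp add: B_def)
  have \<psi>_neg: "?\<psi> a m < 0" if "m \<in> B" "mD a < m" for a m
    using monotone_onD[OF A1_marginal_decreasing[of a], of "mD a" m] mD[of a] that by (simp add: B_def)

  have argmin: "\<exists>q. ?M a m q" if "m \<in> B" for a m
    using Least_is_arg_min(1)[OF feas cont[OF that]] by blast
  \<comment> \<open>At the boundary the marginal value is zero, so zero is still optimal and the tie
    rule can be satisfied.\<close>
  have zero: "?M a m 0" if "m \<in> B" "m = mD a" for a m
    using zero_arg_min A1_convex A1_marginal_exists A1_deployable that mD(2)[of a] by (simp add: B_def)
  \<comment> \<open>Strictly below the boundary optimality forces zero; on it the tie rule
    does.\<close>
  have low: "q = 0" if "m \<in> B" "m \<le> mD a" "m = mD a \<longrightarrow> q = 0" "?M a m q" for a m q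
    using arg_min_eq_zero[OF A1_convex A1_marginal_exists \<psi>_pos that(4)] that by (force simp: B_def)
  have high: "0 < q" if "m \<in> B" "mD a < m" "?M a m q" for a m q
    using arg_min_pos[OF A1_marginal_exists \<psi>_neg A1_deployable that(3)] that by (simp add: B_def)

  show "\<forall>m\<in>belief_set P r.
        let mP = preservation_threshold P r I;
            mD = (\<lambda>a. deployment_threshold P r a I);
            selected = (\<lambda>q a. optimal_action P r m I q a
                          \<and> (m = mP \<longrightarrow> \<not> a) \<and> (m = mD a \<longrightarrow> q = 0))
        in (\<exists>q a. selected q a)
           \<and> (\<forall>q a. selected q a \<longrightarrow>
                (m \<le> mP \<and> m \<le> mD False \<longrightarrow> mode_of q a = Exit)
              \<and> (m \<le> mP \<and> m > mD False \<longrightarrow> mode_of q a = Terminal_Response)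
              \<and> (m > mP \<and> m \<le> mD True \<longrightarrow> mode_of q a = Standby)
              \<and> (m > mP \<and> m > mD True \<longrightarrow> mode_of q a = Sustained_Response))"
    unfolding Let_def mP_def[symmetric] mD_def[symmetric]
  proof (intro ballI)
    fix m assume "m \<in> belief_set P r"
    then have m: "m \<in> B" by (simp add: B_def)
    note opt = optimal_action_iff[OF argmin[OF m]]
    define sel where "sel q a \<longleftrightarrow> optimal_action P r m I q a
        \<and> (m = mP \<longrightarrow> \<not> a) \<and> (m = mD a \<longrightarrow> q = 0)" for q a
    \<comment> \<open>Off \<open>mP\<close> the strict sign of \<open>?G m\<close> minus the
      readiness cost fixes the channel. At \<open>mP\<close> both states are optimal and the tie
      rule picks closing, so \<open>a\<close> always equals \<open>mP < m\<close>.\<close>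
    have sel: "sel q a \<longleftrightarrow> ?M a m q \<and> (a \<longleftrightarrow> mP < m) \<and> (m = mD a \<longrightarrow> q = 0)" for q a
      using G_less[OF m] G_greater[OF m] mP(2) unfolding sel_def opt
      by (cases m mP rule: linorder_cases) auto
    \<comment> \<open>The witness is zero on the deployment boundary of the selected side and any
      minimizer elsewhere.\<close>
    have "\<exists>q. sel q (mP < m)"
      using argmin[OF m] zero[OF m] unfolding sel by metis
    moreover have "mode_of q a = (if mP < m then if mD True < m then Sustained_Response else Standby
        else if mD False < m then Terminal_Response else Exit)" if "sel q a" for q a
    proof -
      have a: "a \<longleftrightarrow> mP < m" and q: "?M a m q" "m = mD a \<longrightarrow> q = 0"
        using that unfolding sel by blast+
      \<comment> \<open>The relevant deployment boundary is that of the selected side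
        \<open>a\<close>; substituting \<open>mP < m\<close> for \<open>a\<close> yields the four
        modes.\<close>
      have "0 < q \<longleftrightarrow> mD a < m"
      proof (cases "mD a < m")
        case True
        then show ?thesis using high[OF m _ q(1)] by simp
      next
        case False
        then have "q = 0" by (intro low[OF m _ q(2,1)]) simp
        with False show ?thesis by simp
      qed
      then show ?thesis
        using a by (cases a) (simp_all add: mode_of_def)
    qed
    ultimately show "(\<exists>q a. optimal_action P r m I q a
          \<and> (m = mP \<longrightarrow> \<not> a) \<and> (m = mD a \<longrightarrow> q = 0))
        \<and> (\<forall>q a. optimal_action P r m I q a
          \<and> (m = mP \<longrightarrow> \<not> a) \<and> (m = mD a \<longrightarrow> q = 0) \<longrightarrow>
                (m \<le> mP \<and> m \<le> mD False \<longrightarrow> mode_of q a = Exit)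
              \<and> (m \<le> mP \<and> m > mD False \<longrightarrow> mode_of q a = Terminal_Response)
              \<and> (m > mP \<and> m \<le> mD True \<longrightarrow> mode_of q a = Standby)
              \<and> (m > mP \<and> m > mD True \<longrightarrow> mode_of q a = Sustained_Response))"
      unfolding sel_def[symmetric] by auto
  qed

  show "\<forall>\<kappa> \<kappa>' m m'. \<kappa> < \<kappa>'
          \<and> is_preservation_threshold (with_readiness_cost P r \<kappa>) r I m
          \<and> is_preservation_threshold (with_readiness_cost P r \<kappa>') r I m'
          \<longrightarrow> m < m'"
    \<comment> \<open>Both thresholds are level points of the same \<open>?G\<close>, so
      \<open>m' \<le> m\<close> would give \<open>\<kappa>' \<le> \<kappa>\<close>.\<close>
    unfolding is_preservation_threshold_def using mono_onD[OF A2(2)] by (simp, meson leD leI)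
  show "\<forall>\<kappa> a m. is_deployment_threshold (with_readiness_cost P r \<kappa>) r a I m
                  \<longleftrightarrow> is_deployment_threshold P r a I m"
    by (simp add: is_deployment_threshold_def)
qed

end
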